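(* Let $S$ be a finite ample semigroup such that $E(S)$ is contained in the center of $S$. Then $S$ is ample in (equivalently, a $(2,1,1)$-subalgebra of) the symmetric inverse semigroup $\mathcal{I}_S$; that is, there exists an injective semigroup homomorphism $\phi: S\longrightarrow \mathcal{I}_S$ such that for all $x\in S$ both $(x\phi)(x\phi)^{-1}\in S\phi$ and $(x\phi)^{-1}(x\phi)\in S\phi$.
   Context: Maps are written to the right of their arguments. For a set $X$, $\mathcal{I}_X$ is the symmetric inverse semigroup over $X$: the set of all bijections $\beta$ between subsets $Dom\,\beta$ and $Im\,\beta$ of $X$ (including the empty map), where $\beta\gamma$ is the composition "$\beta$ followed by $\gamma$" on its maximal domain of definition $\{x\in Dom\,\beta : x\beta\in Dom\,\gamma\}$, and $\beta^{-1}$ is the inverse partial bijection. $E(S)$ is the set of idempotents of $S$. A semigroup $S$ is left ample if there are an inverse semigroup $T$ and an injective homomorphism $\phi:S\to T$ such that $(x\phi)(x\phi)^{-1}\in S\phi$ for all $x\in S$. It is right ample if there are an inverse semigroup $T$ and an injective homomorphism $\phi:S\to T$ such that $(x\phi)^{-1}(x\phi)\in S\phi$ for all $x\in S$. It is ample if it is both left ample and right ample, where the inverse semigroups and embeddings witnessing left and right ampleness may be different. A subsemigroup $S$ of an inverse semigroup $T$ is ample in $T$ if $xx^{-1}\in S$ and $x^{-1}x\in S$ for all $x\in S$; equivalently, $S$ is a $(2,1,1)$-type subalgebra of $(T,\cdot,{}^+,{}^* )$, where $x^+=xx^{-1}$ and $x^*=x^{-1}x$. *)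

theory Defs
  imports "HOL-Algebra.Group"
begin

text \<open>
  Semigroups are carried by the \<^typ>\<open>'a monoid\<close> record, so that \<^const>\<open>hom\<close> can be reused.
  The field \<^const>\<open>one\<close> is neither constrained nor mentioned anywhere below (\<^const>\<open>hom\<close> does not
  mention it either). The empty semigroup is allowed.
\<close>

locale semigroup_struct =
  fixes S (structure)
  assumes mult_closed: "\<lbrakk>x \<in> carrier S; y \<in> carrier S\<rbrakk> \<Longrightarrow> x \<otimes> y \<in> carrier S"
    and mult_assoc:
      "\<lbrakk>x \<in> carrier S; y \<in> carrier S; z \<in> carrier S\<rbrakk> \<Longrightarrow> (x \<otimes> y) \<otimes> z = x \<otimes> (y \<otimes> z)"

definition is_sg_inverse :: "('a, 'm) monoid_scheme \<Rightarrow> 'a \<Rightarrow> 'a \<Rightarrow> bool" where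
  "is_sg_inverse S x y \<longleftrightarrow>
     y \<in> carrier S \<and> x \<otimes>\<^bsub>S\<^esub> y \<otimes>\<^bsub>S\<^esub> x = x \<and> y \<otimes>\<^bsub>S\<^esub> x \<otimes>\<^bsub>S\<^esub> y = y"

locale inverse_semigroup = semigroup_struct T for T (structure) +
  assumes unique_inverse: "x \<in> carrier T \<Longrightarrow> \<exists>!y. is_sg_inverse T x y"

definition sg_inv :: "('a, 'm) monoid_scheme \<Rightarrow> 'a \<Rightarrow> 'a" where
  "sg_inv T x = (THE y. is_sg_inverse T x y)"

definition idempotents :: "('a, 'm) monoid_scheme \<Rightarrow> 'a set" where
  "idempotents S = {e \<in> carrier S. e \<otimes>\<^bsub>S\<^esub> e = e}"

definition sg_center :: "('a, 'm) monoid_scheme \<Rightarrow> 'a set" where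
  "sg_center S = {z \<in> carrier S. \<forall>x \<in> carrier S. z \<otimes>\<^bsub>S\<^esub> x = x \<otimes>\<^bsub>S\<^esub> z}"

text \<open>
  HOL cannot quantify existentially over the element type of the inverse semigroup \<open>T\<close>, so that
  type is an explicit parameter. In a hypothesis \<open>left_ample TYPE('b) S\<close> of a theorem the type
  variable \<open>'b\<close> is universally quantified over the whole theorem, which is the same as assuming
  that some \<open>T\<close>, over some element type, exists.
\<close>

definition left_ample :: "'b itself \<Rightarrow> ('a, 'm) monoid_scheme \<Rightarrow> bool" where
  "left_ample _ S \<longleftrightarrow> semigroup_struct S \<and>
     (\<exists>(T :: 'b monoid) \<phi>. inverse_semigroup T \<and> \<phi> \<in> hom S T \<and> inj_on \<phi> (carrier S) \<and>
        (\<forall>x \<in> carrier S. \<phi> x \<otimes>\<^bsub>T\<^esub> sg_inv T (\<phi> x) \<in> \<phi> ` carrier S))"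

definition right_ample :: "'b itself \<Rightarrow> ('a, 'm) monoid_scheme \<Rightarrow> bool" where
  "right_ample _ S \<longleftrightarrow> semigroup_struct S \<and>
     (\<exists>(T :: 'b monoid) \<phi>. inverse_semigroup T \<and> \<phi> \<in> hom S T \<and> inj_on \<phi> (carrier S) \<and>
        (\<forall>x \<in> carrier S. sg_inv T (\<phi> x) \<otimes>\<^bsub>T\<^esub> \<phi> x \<in> \<phi> ` carrier S))"

definition ample :: "'b itself \<Rightarrow> 'c itself \<Rightarrow> ('a, 'm) monoid_scheme \<Rightarrow> bool" where
  "ample tb tc S \<longleftrightarrow> left_ample tb S \<and> right_ample tc S"

text \<open>
  Partial maps are composed from left to right: \<open>\<beta>\<close> followed by \<open>\<gamma>\<close> is \<open>\<gamma> \<circ>\<^sub>m \<beta>\<close>,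
  whose domain is \<open>{x \<in> dom \<beta>. the (\<beta> x) \<in> dom \<gamma>}\<close>.
\<close>

definition sym_inv :: "'a set \<Rightarrow> ('a \<rightharpoonup> 'a) monoid" where
  "sym_inv X =
     \<lparr>carrier = {\<beta>. dom \<beta> \<subseteq> X \<and> ran \<beta> \<subseteq> X \<and> inj_on \<beta> (dom \<beta>)},
      mult = (\<lambda>\<beta> \<gamma>. \<gamma> \<circ>\<^sub>m \<beta>),
      one = (\<lambda>x. if x \<in> X then Some x else None)\<rparr>"

definition partial_inverse :: "('a \<rightharpoonup> 'b) \<Rightarrow> ('b \<rightharpoonup> 'a)" where
  "partial_inverse \<beta> = (\<lambda>y. if y \<in> ran \<beta> then Some (THE x. \<beta> x = Some y) else None)"

text \<open>
  The remaining lemmas show that \<^const>\<open>sym_inv\<close> is an inverse semigroup in which \<^const>\<open>sg_inv\<close> is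
  the inverse partial bijection.
\<close>

lemma partial_inverse_Some_iff:
  assumes "inj_on \<beta> (dom \<beta>)"
  shows "partial_inverse \<beta> y = Some x \<longleftrightarrow> \<beta> x = Some y"
proof -
  have u: "x' = x" if "\<beta> x = Some y" "\<beta> x' = Some y" for x x'
    using that inj_onD[OF assms, of x' x] by auto
  have t: "(THE x. \<beta> x = Some y) = x" if "\<beta> x = Some y" for x
    using that u by (intro the_equality)
  show ?thesis
    using t by (auto simp: partial_inverse_def ran_def)
qed

lemma sym_inv_carrier_iff:
  "\<beta> \<in> carrier (sym_inv X) \<longleftrightarrow>
     (\<forall>x y. \<beta> x = Some y \<longrightarrow> x \<in> X \<and> y \<in> X) \<and>
     (\<forall>x x' y. \<beta> x = Some y \<longrightarrow> \<beta> x' = Some y \<longrightarrow> x = x')"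
proof -
  have "inj_on \<beta> (dom \<beta>) \<longleftrightarrow> (\<forall>x x' y. \<beta> x = Some y \<longrightarrow> \<beta> x' = Some y \<longrightarrow> x = x')"
    unfolding inj_on_def dom_def by auto
  moreover have "dom \<beta> \<subseteq> X \<and> ran \<beta> \<subseteq> X \<longleftrightarrow> (\<forall>x y. \<beta> x = Some y \<longrightarrow> x \<in> X \<and> y \<in> X)"
    unfolding dom_def ran_def by auto
  ultimately show ?thesis
    by (simp add: sym_inv_def flip: conj_assoc)
qed

lemma sym_inv_mult_Some_iff:
  "(\<beta> \<otimes>\<^bsub>sym_inv X\<^esub> \<gamma>) x = Some z \<longleftrightarrow> (\<exists>y. \<beta> x = Some y \<and> \<gamma> y = Some z)"
  by (auto simp: sym_inv_def map_comp_Some_iff)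

lemma map_eqI_Some: "(\<And>x y. f x = Some y \<longleftrightarrow> g x = Some y) \<Longrightarrow> f = g"
  by (rule ext) (metis option.exhaust)

lemma is_sg_inverse_sym_inv_iff:
  assumes "\<beta> \<in> carrier (sym_inv X)"
  shows "is_sg_inverse (sym_inv X) \<beta> \<gamma> \<longleftrightarrow> \<gamma> = partial_inverse \<beta>"
proof -
  have inj: "inj_on \<beta> (dom \<beta>)"
    using assms by (simp add: sym_inv_def)
  note p = partial_inverse_Some_iff[OF inj]
  note c = assms[unfolded sym_inv_carrier_iff]
  show ?thesis
  proof
    assume "\<gamma> = partial_inverse \<beta>"
    moreover have "partial_inverse \<beta> \<in> carrier (sym_inv X)"
      using c by (auto simp: sym_inv_carrier_iff p)
    moreover have "\<beta> \<otimes>\<^bsub>sym_inv X\<^esub> partial_inverse \<beta> \<otimes>\<^bsub>sym_inv X\<^esub> \<beta> = \<beta>"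
      using c by (intro map_eqI_Some) (auto simp: sym_inv_mult_Some_iff p)
    moreover have "partial_inverse \<beta> \<otimes>\<^bsub>sym_inv X\<^esub> \<beta> \<otimes>\<^bsub>sym_inv X\<^esub> partial_inverse \<beta> = partial_inverse \<beta>"
      using c by (intro map_eqI_Some) (auto simp: sym_inv_mult_Some_iff p)
    ultimately show "is_sg_inverse (sym_inv X) \<beta> \<gamma>"
      by (simp add: is_sg_inverse_def)
  next
    assume a: "is_sg_inverse (sym_inv X) \<beta> \<gamma>"
    have g: "\<forall>x x' y. \<gamma> x = Some y \<longrightarrow> \<gamma> x' = Some y \<longrightarrow> x = x'"
      using a by (simp add: is_sg_inverse_def sym_inv_carrier_iff)
    have 1: "\<exists>y z. \<beta> x = Some y \<and> \<gamma> y = Some z \<and> \<beta> z = Some w" if "\<beta> x = Some w" for x w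
      proof -
      have "(\<beta> \<otimes>\<^bsub>sym_inv X\<^esub> \<gamma> \<otimes>\<^bsub>sym_inv X\<^esub> \<beta>) x = Some w"
        using a that by (simp add: is_sg_inverse_def)
      then show ?thesis by (auto simp: sym_inv_mult_Some_iff)
    qed
    have 2: "\<exists>y z. \<gamma> x = Some y \<and> \<beta> y = Some z \<and> \<gamma> z = Some w" if "\<gamma> x = Some w" for x w
      proof -
      have "(\<gamma> \<otimes>\<^bsub>sym_inv X\<^esub> \<beta> \<otimes>\<^bsub>sym_inv X\<^esub> \<gamma>) x = Some w"
        using a that by (simp add: is_sg_inverse_def)
      then show ?thesis by (auto simp: sym_inv_mult_Some_iff)
    qed
    show "\<gamma> = partial_inverse \<beta>"
    proof (rule map_eqI_Some)
      fix x y
      show "\<gamma> x = Some y \<longleftrightarrow> partial_inverse \<beta> x = Some y"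
        unfolding p
      proof
        assume gx: "\<gamma> x = Some y"
        with 2 obtain z where z: "\<beta> y = Some z" "\<gamma> z = Some y"
          by fastforce
        with gx g have "z = x" by blast
        with z show "\<beta> y = Some x" by simp
      next
        assume b: "\<beta> y = Some x"
        with 1 obtain z where z: "\<gamma> x = Some z" "\<beta> z = Some x"
          by fastforce
        with b c have "z = y" by blast
        with z show "\<gamma> x = Some y" by simp
      qed
    qed
  qed
qed

lemma inverse_semigroup_sym_inv: "inverse_semigroup (sym_inv X)"
proof
  fix x y z :: "'a \<rightharpoonup> 'a"
  assume xy: "x \<in> carrier (sym_inv X)" "y \<in> carrier (sym_inv X)"
  show "x \<otimes>\<^bsub>sym_inv X\<^esub> y \<in> carrier (sym_inv X)"
    using xy unfolding sym_inv_carrier_iff sym_inv_mult_Some_iff by blast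
  show "x \<otimes>\<^bsub>sym_inv X\<^esub> y \<otimes>\<^bsub>sym_inv X\<^esub> z = x \<otimes>\<^bsub>sym_inv X\<^esub> (y \<otimes>\<^bsub>sym_inv X\<^esub> z)"
    by (rule map_eqI_Some) (auto simp: sym_inv_mult_Some_iff)
next
  fix x assume "x \<in> carrier (sym_inv X)"
  then show "\<exists>!y. is_sg_inverse (sym_inv X) x y"
    by (simp add: is_sg_inverse_sym_inv_iff)
qed

lemma sg_inv_sym_inv:
  "\<beta> \<in> carrier (sym_inv X) \<Longrightarrow> sg_inv (sym_inv X) \<beta> = partial_inverse \<beta>"
  by (simp add: sg_inv_def is_sg_inverse_sym_inv_iff)

end

theory Submission
  imports Defs
begin

text \<open>
  Left ampleness gives each \<open>x\<close> an idempotent \<open>x\<^sup>+\<close> of \<open>S\<close> itself which behaves like the idempotent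
  \<open>x x\<^sup>-\<^sup>1\<close> of an inverse semigroup: \<open>x\<^sup>+ x = x\<close>, and \<open>z x = w x\<close> implies \<open>z x\<^sup>+ = w x\<^sup>+\<close>. The embedding
  is the Vagner--Preston representation, sending \<open>x\<close> to the right translation \<open>s \<mapsto> s x\<close> restricted
  to \<open>S x\<^sup>+ = {s. s x\<^sup>+ = s}\<close>. The translation is injective there by the cancellation property.
  Since \<open>x\<^sup>+\<close> is central, \<open>s x x\<^sup>+ = s x\<close>, so the translation maps \<open>S x\<^sup>+\<close> into itself, and as \<open>S\<close>
  is finite it is a permutation of \<open>S x\<^sup>+\<close>. Hence both idempotents associated with it in the
  symmetric inverse semigroup are the identity on \<open>S x\<^sup>+\<close>, which is the image of \<open>x\<^sup>+\<close>.

  That composition is respected, including domains, comes down to \<open>(x y)\<^sup>+ = x\<^sup>+ y\<^sup>+\<close>, again a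
  consequence of centrality. Injectivity of the representation holds because \<open>x\<^sup>+\<close> is recovered
  from the domain and \<open>x\<close> is the image of \<open>x\<^sup>+\<close>.
\<close>

text \<open>
  The properties of \<open>x x\<^sup>-\<^sup>1\<close> that can be expressed inside \<open>S\<close>, without the surrounding inverse
  semigroup; together they say that \<open>e\<close> and \<open>x\<close> are related by the generalized Green relation
  \<open>R\<^sup>*\<close>.
\<close>

definition is_plus :: "('a, 'm) monoid_scheme \<Rightarrow> 'a \<Rightarrow> 'a \<Rightarrow> bool" where
  "is_plus S x e \<longleftrightarrow> e \<in> idempotents S \<and> e \<otimes>\<^bsub>S\<^esub> x = x \<and>
     (\<forall>z \<in> carrier S. \<forall>w \<in> carrier S. z \<otimes>\<^bsub>S\<^esub> x = w \<otimes>\<^bsub>S\<^esub> x \<longrightarrow> z \<otimes>\<^bsub>S\<^esub> e = w \<otimes>\<^bsub>S\<^esub> e)"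

definition sg_plus :: "('a, 'm) monoid_scheme \<Rightarrow> 'a \<Rightarrow> 'a" where
  "sg_plus S x = (THE e. is_plus S x e)"

text \<open>
  Take for \<open>e\<close> the preimage of \<open>x x\<^sup>-\<^sup>1\<close>. Idempotency, \<open>e x = x\<close> and cancellation involve only
  equations between elements of \<open>S\<close>, so the injective homomorphism reflects them from the inverse
  semigroup.
\<close>

lemma left_ample_imp_ex_plus:
  assumes "left_ample TYPE('b) S" and x: "x \<in> carrier S"
  shows "\<exists>e. is_plus S x e"
proof -
  interpret S: semigroup_struct S
    using assms(1) by (simp add: left_ample_def)
  obtain T :: "'b monoid" and \<phi> where T: "inverse_semigroup T" and hom: "\<phi> \<in> hom S T"
    and inj: "inj_on \<phi> (carrier S)"
    and amp: "\<forall>x \<in> carrier S. \<phi> x \<otimes>\<^bsub>T\<^esub> sg_inv T (\<phi> x) \<in> \<phi> ` carrier S"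
    using assms(1) by (auto simp: left_ample_def)
  interpret T: inverse_semigroup T by fact
  have cl: "\<phi> y \<in> carrier T" if "y \<in> carrier S" for y
    using hom that by (auto simp: hom_def)
  have mul: "\<phi> (y \<otimes>\<^bsub>S\<^esub> z) = \<phi> y \<otimes>\<^bsub>T\<^esub> \<phi> z" if "y \<in> carrier S" "z \<in> carrier S" for y z
    using hom that by (auto simp: hom_def)
  define u where "u = sg_inv T (\<phi> x)"
  have "is_sg_inverse T (\<phi> x) u"
    unfolding u_def sg_inv_def by (rule theI') (rule T.unique_inverse[OF cl[OF x]])
  then have u: "u \<in> carrier T" and xux: "\<phi> x \<otimes>\<^bsub>T\<^esub> u \<otimes>\<^bsub>T\<^esub> \<phi> x = \<phi> x"
    by (simp_all add: is_sg_inverse_def)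
  obtain e where e: "e \<in> carrier S" and \<phi>e: "\<phi> e = \<phi> x \<otimes>\<^bsub>T\<^esub> u"
    using amp x by (force simp: u_def)
  have "\<phi> (e \<otimes>\<^bsub>S\<^esub> e) = \<phi> e"
  proof -
    have "\<phi> e \<otimes>\<^bsub>T\<^esub> \<phi> e = (\<phi> x \<otimes>\<^bsub>T\<^esub> u \<otimes>\<^bsub>T\<^esub> \<phi> x) \<otimes>\<^bsub>T\<^esub> u"
      by (simp add: \<phi>e T.mult_assoc T.mult_closed u cl x)
    then show ?thesis by (simp add: xux mul e \<phi>e)
  qed
  then have "e \<in> idempotents S"
    using inj_onD[OF inj] e S.mult_closed by (auto simp: idempotents_def)
  moreover have "e \<otimes>\<^bsub>S\<^esub> x = x"
    using inj_onD[OF inj, of "e \<otimes>\<^bsub>S\<^esub> x" x] by (simp add: mul \<phi>e xux e x S.mult_closed)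
  moreover have "z \<otimes>\<^bsub>S\<^esub> e = w \<otimes>\<^bsub>S\<^esub> e"
    if z: "z \<in> carrier S" and w: "w \<in> carrier S" and eq: "z \<otimes>\<^bsub>S\<^esub> x = w \<otimes>\<^bsub>S\<^esub> x" for z w
  proof -
    have "\<phi> z \<otimes>\<^bsub>T\<^esub> \<phi> x = \<phi> w \<otimes>\<^bsub>T\<^esub> \<phi> x"
      using arg_cong[OF eq, of \<phi>] by (simp add: mul z w x)
    then have "\<phi> z \<otimes>\<^bsub>T\<^esub> \<phi> e = \<phi> w \<otimes>\<^bsub>T\<^esub> \<phi> e"
      by (simp add: \<phi>e cl x z w u flip: T.mult_assoc)
    then show ?thesis
      using inj_onD[OF inj, of "z \<otimes>\<^bsub>S\<^esub> e" "w \<otimes>\<^bsub>S\<^esub> e"] by (simp add: mul z w e S.mult_closed)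
  qed
  ultimately show ?thesis
    unfolding is_plus_def by blast
qed

locale central_plus_semigroup = semigroup_struct S for S (structure) +
  assumes finite_carrier: "finite (carrier S)"
    and idempotents_central: "idempotents S \<subseteq> sg_center S"
    and ex_plus: "x \<in> carrier S \<Longrightarrow> \<exists>e. is_plus S x e"
begin

lemma idempotent_commute:
  assumes "e \<in> idempotents S" "x \<in> carrier S"
  shows "e \<otimes> x = x \<otimes> e"
  using assms idempotents_central by (auto simp: sg_center_def)

text \<open>
  If \<open>e\<close> and \<open>f\<close> both fix \<open>x\<close>, cancelling \<open>x\<close> from \<open>e x = f x\<close> gives \<open>e = f e\<close>, and symmetrically
  \<open>f = e f\<close>.
\<close>

lemma is_plus_unique:
  assumes "x \<in> carrier S" "is_plus S x e" "is_plus S x f"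
  shows "e = f"
proof -
  have e: "e \<in> idempotents S" "e \<otimes> x = x" and f: "f \<in> idempotents S" "f \<otimes> x = x"
    using assms unfolding is_plus_def by blast+
  then have "e \<in> carrier S" "f \<in> carrier S" "e \<otimes> x = f \<otimes> x"
    by (simp_all add: idempotents_def)
  then have "e \<otimes> e = f \<otimes> e" "e \<otimes> f = f \<otimes> f"
    using assms(2,3) unfolding is_plus_def by blast+
  moreover have "f \<otimes> e = e \<otimes> f"
    using idempotent_commute[OF f(1), of e] e by (simp add: idempotents_def)
  ultimately show ?thesis
    using e f by (simp add: idempotents_def)
qed

lemma sg_plus_eqI: "\<lbrakk>x \<in> carrier S; is_plus S x e\<rbrakk> \<Longrightarrow> sg_plus S x = e"
  unfolding sg_plus_def by (blast intro: the_equality is_plus_unique)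

lemma is_plus_sg_plus: "x \<in> carrier S \<Longrightarrow> is_plus S x (sg_plus S x)"
  using ex_plus sg_plus_eqI by metis

lemma sg_plus_idempotent: "x \<in> carrier S \<Longrightarrow> sg_plus S x \<in> idempotents S"
  using is_plus_sg_plus unfolding is_plus_def by blast

lemma sg_plus_closed: "x \<in> carrier S \<Longrightarrow> sg_plus S x \<in> carrier S"
  using sg_plus_idempotent[of x] by (simp add: idempotents_def)

lemma sg_plus_square: "x \<in> carrier S \<Longrightarrow> sg_plus S x \<otimes> sg_plus S x = sg_plus S x"
  using sg_plus_idempotent[of x] by (simp add: idempotents_def)

lemma sg_plus_mult: "x \<in> carrier S \<Longrightarrow> sg_plus S x \<otimes> x = x"
  using is_plus_sg_plus unfolding is_plus_def by blast

lemma mult_sg_plus: "x \<in> carrier S \<Longrightarrow> x \<otimes> sg_plus S x = x"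
  using idempotent_commute[OF sg_plus_idempotent] sg_plus_mult by metis

lemma sg_plus_cancel:
  "\<lbrakk>z \<otimes> x = w \<otimes> x; x \<in> carrier S; z \<in> carrier S; w \<in> carrier S\<rbrakk>
    \<Longrightarrow> z \<otimes> sg_plus S x = w \<otimes> sg_plus S x"
  using is_plus_sg_plus unfolding is_plus_def by blast

lemma sg_plus_of_idempotent: "e \<in> idempotents S \<Longrightarrow> sg_plus S e = e"
  by (rule sg_plus_eqI) (auto simp: is_plus_def idempotents_def)

text \<open>
  By uniqueness it suffices that \<open>x\<^sup>+ y\<^sup>+\<close> has the defining properties for \<open>x y\<close>. To cancel \<open>x y\<close>,
  cancel \<open>y\<close>, move the resulting \<open>y\<^sup>+\<close> to the left of \<open>x\<close>, and cancel \<open>x\<close>.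
\<close>

lemma sg_plus_of_mult:
  assumes x: "x \<in> carrier S" and y: "y \<in> carrier S"
  shows "sg_plus S (x \<otimes> y) = sg_plus S x \<otimes> sg_plus S y"
proof (rule sg_plus_eqI)
  let ?e = "sg_plus S x" and ?f = "sg_plus S y"
  note cl = x y sg_plus_closed[OF x] sg_plus_closed[OF y] mult_closed
  have fe: "?f \<otimes> x = x \<otimes> ?f" "?f \<otimes> ?e = ?e \<otimes> ?f"
    by (rule idempotent_commute[OF sg_plus_idempotent[OF y]]; rule cl)+
  show "x \<otimes> y \<in> carrier S" using x y by (rule mult_closed)
  have "?e \<otimes> ?f \<otimes> (?e \<otimes> ?f) = ?e \<otimes> (?f \<otimes> ?e) \<otimes> ?f"
    by (simp add: mult_assoc cl)
  also have "\<dots> = ?e \<otimes> ?e \<otimes> (?f \<otimes> ?f)"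
    by (simp add: mult_assoc cl fe)
  finally have idem: "?e \<otimes> ?f \<in> idempotents S"
    by (simp add: idempotents_def cl sg_plus_square)
  have "?e \<otimes> ?f \<otimes> (x \<otimes> y) = ?e \<otimes> (?f \<otimes> x) \<otimes> y"
    by (simp add: mult_assoc cl)
  also have "\<dots> = (?e \<otimes> x) \<otimes> (?f \<otimes> y)"
    by (simp add: mult_assoc cl fe)
  finally have left: "?e \<otimes> ?f \<otimes> (x \<otimes> y) = x \<otimes> y"
    by (simp add: sg_plus_mult x y)
  have "z \<otimes> (?e \<otimes> ?f) = w \<otimes> (?e \<otimes> ?f)"
    if z: "z \<in> carrier S" and w: "w \<in> carrier S" and eq: "z \<otimes> (x \<otimes> y) = w \<otimes> (x \<otimes> y)" for z w
  proof -
    have move: "v \<otimes> x \<otimes> ?f = v \<otimes> ?f \<otimes> x" "v \<otimes> ?f \<otimes> ?e = v \<otimes> (?e \<otimes> ?f)"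
      if "v \<in> carrier S" for v
      by (simp_all add: mult_assoc cl that fe)
    have "z \<otimes> x \<otimes> y = w \<otimes> x \<otimes> y"
      using eq by (simp add: mult_assoc z w x y)
    then have "z \<otimes> x \<otimes> ?f = w \<otimes> x \<otimes> ?f"
      by (rule sg_plus_cancel) (simp_all add: cl z w)
    then have "z \<otimes> ?f \<otimes> x = w \<otimes> ?f \<otimes> x"
      by (simp add: move z w)
    then have "z \<otimes> ?f \<otimes> ?e = w \<otimes> ?f \<otimes> ?e"
      by (rule sg_plus_cancel) (simp_all add: cl z w)
    then show ?thesis
      by (simp add: move z w)
  qed
  with idem left show "is_plus S (x \<otimes> y) (?e \<otimes> ?f)"
    unfolding is_plus_def by blast
qed

definition fixed_by_plus :: "'a \<Rightarrow> 'a set" where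
  "fixed_by_plus x = {s \<in> carrier S. s \<otimes> sg_plus S x = s}"

definition translation :: "'a \<Rightarrow> ('a \<rightharpoonup> 'a)" where
  "translation x = (\<lambda>s. if s \<in> fixed_by_plus x then Some (s \<otimes> x) else None)"

lemma translation_Some_iff: "translation x s = Some t \<longleftrightarrow> s \<in> fixed_by_plus x \<and> t = s \<otimes> x"
  by (auto simp: translation_def)

lemma inj_on_translation:
  assumes x: "x \<in> carrier S"
  shows "inj_on (\<lambda>s. s \<otimes> x) (fixed_by_plus x)"
proof (rule inj_onI)
  fix s t
  assume s: "s \<in> fixed_by_plus x" and t: "t \<in> fixed_by_plus x" and "s \<otimes> x = t \<otimes> x"
  then have "s \<otimes> sg_plus S x = t \<otimes> sg_plus S x"
    unfolding fixed_by_plus_def by (intro sg_plus_cancel x) auto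
  with s t show "s = t"
    by (simp add: fixed_by_plus_def)
qed

text \<open>
  This is where finiteness enters: an injective self-map of a finite set is onto.
\<close>

lemma image_translation:
  assumes x: "x \<in> carrier S"
  shows "(\<lambda>s. s \<otimes> x) ` fixed_by_plus x = fixed_by_plus x"
proof (rule endo_inj_surj)
  show "finite (fixed_by_plus x)"
    using finite_carrier by (simp add: fixed_by_plus_def)
  show "(\<lambda>s. s \<otimes> x) ` fixed_by_plus x \<subseteq> fixed_by_plus x"
    using x by (auto simp: fixed_by_plus_def mult_closed mult_assoc mult_sg_plus sg_plus_closed)
qed (rule inj_on_translation[OF x])

lemma translation_in_sym_inv:
  assumes x: "x \<in> carrier S"
  shows "translation x \<in> carrier (sym_inv (carrier S))"
  unfolding sym_inv_carrier_iff translation_Some_iff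
  using inj_onD[OF inj_on_translation[OF x]] x mult_closed unfolding fixed_by_plus_def by blast

text \<open>
  The composite is defined at \<open>s\<close> when \<open>s x\<^sup>+ = s\<close> and \<open>s x y\<^sup>+ = s x\<close>. Moving \<open>y\<^sup>+\<close> past \<open>x\<close> and
  cancelling \<open>x\<close> turns the second condition into \<open>s y\<^sup>+ = s\<close>.
\<close>

lemma fixed_by_plus_mult_iff:
  assumes x: "x \<in> carrier S" and y: "y \<in> carrier S"
  shows "s \<in> fixed_by_plus (x \<otimes> y) \<longleftrightarrow> s \<in> fixed_by_plus x \<and> s \<otimes> x \<in> fixed_by_plus y"
proof (cases "s \<in> carrier S")
  case s: True
  let ?e = "sg_plus S x" and ?f = "sg_plus S y"
  note cl = x y s sg_plus_closed[OF x] sg_plus_closed[OF y] mult_closed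
  have f: "?f \<otimes> x = x \<otimes> ?f" "?f \<otimes> ?e = ?e \<otimes> ?f"
    by (rule idempotent_commute[OF sg_plus_idempotent[OF y]]; rule cl)+
  have sxf: "s \<otimes> x \<otimes> ?f = s \<otimes> ?f \<otimes> x"
    by (simp add: mult_assoc cl f)
  have "s \<otimes> ?e = s \<and> s \<otimes> x \<otimes> ?f = s \<otimes> x" if eq: "s \<otimes> (?e \<otimes> ?f) = s"
  proof
    have feq: "s \<otimes> (?f \<otimes> ?e) = s"
      unfolding f(2) by (rule eq)
    have "s \<otimes> ?e = s \<otimes> (?f \<otimes> ?e) \<otimes> ?e"
      unfolding feq ..
    also have "\<dots> = s \<otimes> (?f \<otimes> ?e)"
      by (simp add: mult_assoc cl sg_plus_square)
    also note feq
    finally show "s \<otimes> ?e = s" .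
    have "s \<otimes> ?f = s \<otimes> (?e \<otimes> ?f) \<otimes> ?f"
      using eq by simp
    also have "\<dots> = s \<otimes> (?e \<otimes> ?f)"
      by (simp add: mult_assoc cl sg_plus_square)
    finally show "s \<otimes> x \<otimes> ?f = s \<otimes> x"
      unfolding sxf eq by simp
  qed
  moreover have "s \<otimes> (?e \<otimes> ?f) = s" if se: "s \<otimes> ?e = s" and sf: "s \<otimes> x \<otimes> ?f = s \<otimes> x"
  proof -
    have "s \<otimes> ?f \<otimes> x = s \<otimes> x"
      using sf sxf by simp
    then have "s \<otimes> ?f \<otimes> ?e = s \<otimes> ?e"
      by (rule sg_plus_cancel) (simp_all add: cl)
    then show ?thesis
      using se by (simp add: mult_assoc cl f)
  qed
  ultimately show ?thesis
    by (auto simp: fixed_by_plus_def sg_plus_of_mult cl)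
qed (simp add: fixed_by_plus_def)

lemma translation_mult:
  assumes x: "x \<in> carrier S" and y: "y \<in> carrier S"
  shows "translation (x \<otimes> y) = translation x \<otimes>\<^bsub>sym_inv (carrier S)\<^esub> translation y"
proof (rule map_eqI_Some)
  fix s t
  have "s \<otimes> (x \<otimes> y) = s \<otimes> x \<otimes> y" if "s \<in> fixed_by_plus x"
    using that x y by (simp add: fixed_by_plus_def mult_assoc)
  then show "translation (x \<otimes> y) s = Some t \<longleftrightarrow>
      (translation x \<otimes>\<^bsub>sym_inv (carrier S)\<^esub> translation y) s = Some t"
    unfolding sym_inv_mult_Some_iff translation_Some_iff fixed_by_plus_mult_iff[OF x y] by auto
qed

lemma translation_hom: "translation \<in> hom S (sym_inv (carrier S))"
  by (auto simp: hom_def translation_in_sym_inv translation_mult)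

text \<open>
  The idempotent \<open>x\<^sup>+\<close> lies in the domain of the translation by \<open>x\<close>, with value \<open>x\<close>. If \<open>x\<close> and \<open>y\<close>
  have the same translation, then \<open>x\<^sup>+\<close> lies in the domain for \<open>y\<close> and conversely, which makes
  these commuting idempotents equal.
\<close>

lemma inj_translation: "inj_on translation (carrier S)"
proof (rule inj_onI)
  fix x y
  assume x: "x \<in> carrier S" and y: "y \<in> carrier S" and eq: "translation x = translation y"
  have val: "translation z (sg_plus S z) = Some z" if "z \<in> carrier S" for z
    using that
    by (simp add: translation_Some_iff fixed_by_plus_def sg_plus_closed sg_plus_square sg_plus_mult)
  have "translation y (sg_plus S x) = Some x" "translation x (sg_plus S y) = Some y"
    using val[OF x] val[OF y] eq by simp_all
  then have "sg_plus S x \<otimes> sg_plus S y = sg_plus S x" "sg_plus S y \<otimes> sg_plus S x = sg_plus S y"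
    by (simp_all add: translation_Some_iff fixed_by_plus_def)
  moreover have "sg_plus S x \<otimes> sg_plus S y = sg_plus S y \<otimes> sg_plus S x"
    by (rule idempotent_commute[OF sg_plus_idempotent[OF x] sg_plus_closed[OF y]])
  ultimately have "sg_plus S x = sg_plus S y" by metis
  then show "x = y"
    using val[OF x] val[OF y] eq by (metis option.inject)
qed

lemma translation_sg_plus_Some_iff:
  assumes x: "x \<in> carrier S"
  shows "translation (sg_plus S x) s = Some t \<longleftrightarrow> s \<in> fixed_by_plus x \<and> t = s"
  using sg_plus_of_idempotent[OF sg_plus_idempotent[OF x]]
  by (auto simp: translation_Some_iff fixed_by_plus_def)

lemma translation_mult_inverse:
  assumes x: "x \<in> carrier S"
  shows "translation x \<otimes>\<^bsub>sym_inv (carrier S)\<^esub> sg_inv (sym_inv (carrier S)) (translation x) =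
    translation (sg_plus S x)"
proof (rule map_eqI_Some)
  have inj: "inj_on (translation x) (dom (translation x))"
    using translation_in_sym_inv[OF x] by (simp add: sym_inv_def)
  show "(translation x \<otimes>\<^bsub>sym_inv (carrier S)\<^esub> sg_inv (sym_inv (carrier S)) (translation x)) s = Some t
      \<longleftrightarrow> translation (sg_plus S x) s = Some t" for s t
    unfolding sg_inv_sym_inv[OF translation_in_sym_inv[OF x]] sym_inv_mult_Some_iff
      partial_inverse_Some_iff[OF inj] translation_sg_plus_Some_iff[OF x]
    unfolding translation_Some_iff
    by (auto dest: inj_onD[OF inj_on_translation[OF x]])
qed

text \<open>The domain and the range of the translation by \<open>x\<close> coincide, hence the same idempotent.\<close>

lemma inverse_mult_translation:
  assumes x: "x \<in> carrier S"
  shows "sg_inv (sym_inv (carrier S)) (translation x) \<otimes>\<^bsub>sym_inv (carrier S)\<^esub> translation x =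
    translation (sg_plus S x)"
proof (rule map_eqI_Some)
  have inj: "inj_on (translation x) (dom (translation x))"
    using translation_in_sym_inv[OF x] by (simp add: sym_inv_def)
  show "(sg_inv (sym_inv (carrier S)) (translation x) \<otimes>\<^bsub>sym_inv (carrier S)\<^esub> translation x) s = Some t
      \<longleftrightarrow> translation (sg_plus S x) s = Some t" for s t
    unfolding sg_inv_sym_inv[OF translation_in_sym_inv[OF x]] sym_inv_mult_Some_iff
      partial_inverse_Some_iff[OF inj] translation_sg_plus_Some_iff[OF x]
    unfolding translation_Some_iff
    using image_translation[OF x] by blast
qed

end

theorem corollary2p10:
  fixes S :: "'a monoid"
  assumes "semigroup_struct S"
    and "finite (carrier S)"
    and "ample TYPE('b) TYPE('c) S"
    and "idempotents S \<subseteq> sg_center S"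
  shows "\<exists>\<phi>. \<phi> \<in> hom S (sym_inv (carrier S)) \<and> inj_on \<phi> (carrier S) \<and>
    (\<forall>x \<in> carrier S.
       \<phi> x \<otimes>\<^bsub>sym_inv (carrier S)\<^esub> sg_inv (sym_inv (carrier S)) (\<phi> x) \<in> \<phi> ` carrier S \<and>
       sg_inv (sym_inv (carrier S)) (\<phi> x) \<otimes>\<^bsub>sym_inv (carrier S)\<^esub> \<phi> x \<in> \<phi> ` carrier S)"
proof -
  have "left_ample TYPE('b) S"
    using assms(3) by (simp add: ample_def)
  then interpret central_plus_semigroup S
    using assms(1,2,4)
    by (intro central_plus_semigroup.intro central_plus_semigroup_axioms.intro left_ample_imp_ex_plus)
  show ?thesis
    by (intro exI[of _ translation])
      (simp add: translation_hom inj_translation translation_mult_inverse inverse_mult_translation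
        sg_plus_closed)
qed

end
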